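(* Let $k\ge 2$ and let $S$ be a shifted $k$-family on vertex set $[n]$ with $f_{k-1}(S)$ facets and Laplacian eigenvalues $\lambda_1\ge\lambda_2\ge\cdots$. Then for every positive integer $t$, $$\sum_{i=1}^{t} \lambda_i \leq (k-1) f_{k-1}(S) + \binom{t+k-1}{k}.$$
   Context: A $k$-family on vertex set $[n]$ is a pure $(k-1)$-dimensional abstract simplicial complex, determined by a nonempty set of $k$-element subsets of $[n]$ (its facets); $f_{k-1}(S)$ is the number of facets. Let $\partial_{k-1}$ be the matrix with rows indexed by the $(k-1)$-element subsets of $[n]$ and columns by the facets, with entry $(-1)^j$ in row $G$, column $F=\{v_0<\cdots<v_{k-1}\}$ if $G=F\setminus\{v_j\}$, and $0$ otherwise. The Laplacian is $L(S)=\partial_{k-1}\partial_{k-1}^T$ with eigenvalues $\lambda_1\ge\lambda_2\ge\cdots\ge0$; set $\lambda_i=0$ for $i>\binom{n}{k-1}$. $S$ is shifted if its vertices can be labeled by $[n]$ so that whenever $F$ is a facet, $v\in F$, $u\notin F$ and $u<v$, the set $(F\setminus\{v\})\cup\{u\}$ is also a facet (equivalently, the facets form an order ideal in the componentwise (Gale) order on increasing $k$-tuples). *)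

theory Defs
  imports "Jordan_Normal_Form.Char_Poly" "HOL-Computational_Algebra.Polynomial_Factorial"
begin

text \<open>
  A pure complex of dimension \<open>k - 1\<close> is represented by its set of facets, which determines it.
  Not every element of \<open>{1..n}\<close> need lie in a facet.
\<close>

definition k_family :: "nat \<Rightarrow> nat \<Rightarrow> nat set set \<Rightarrow> bool" where
  "k_family n k S \<longleftrightarrow> S \<noteq> {} \<and> (\<forall>F\<in>S. F \<subseteq> {1..n} \<and> card F = k)"

definition exchange_closed :: "nat \<Rightarrow> nat set set \<Rightarrow> bool" where
  "exchange_closed n S \<longleftrightarrow>
     (\<forall>F\<in>S. \<forall>v\<in>F. \<forall>u\<in>{1..n}. u \<notin> F \<longrightarrow> u < v \<longrightarrow> insert u (F - {v}) \<in> S)"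

text \<open>
  The bijection \<open>\<pi>\<close> is the labelling of the vertices witnessing shiftedness; it is not required
  to be the identity.
\<close>

definition shifted :: "nat \<Rightarrow> nat set set \<Rightarrow> bool" where
  "shifted n S \<longleftrightarrow> (\<exists>\<pi>. bij_betw \<pi> {1..n} {1..n} \<and> exchange_closed n ((`) \<pi> ` S))"

text \<open>
  A duplicate-free enumeration of the \<open>m\<close>-element subsets of \<open>{1..n}\<close>, used to index the rows
  and columns of the boundary matrix by natural numbers.
\<close>

definition subsets_of_card :: "nat \<Rightarrow> nat \<Rightarrow> nat set list" where
  "subsets_of_card n m = filter (\<lambda>G. card G = m) (map set (subseqs [1..<Suc n]))"

definition facet_list :: "nat \<Rightarrow> nat \<Rightarrow> nat set set \<Rightarrow> nat set list" where
  "facet_list n k S = filter (\<lambda>F. F \<in> S) (subsets_of_card n k)"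

definition boundary_entry :: "nat set \<Rightarrow> nat set \<Rightarrow> real" where
  "boundary_entry G F =
     (if \<exists>j < card F. G = F - {sorted_list_of_set F ! j}
      then (- 1) ^ (THE j. j < card F \<and> G = F - {sorted_list_of_set F ! j})
      else 0)"

definition boundary_mat :: "nat \<Rightarrow> nat \<Rightarrow> nat set set \<Rightarrow> real mat" where
  "boundary_mat n k S =
     (let rs = subsets_of_card n (k - 1); cs = facet_list n k S
      in mat (length rs) (length cs) (\<lambda>(i, j). boundary_entry (rs ! i) (cs ! j)))"

definition laplacian :: "nat \<Rightarrow> nat \<Rightarrow> nat set set \<Rightarrow> real mat" where
  "laplacian n k S = boundary_mat n k S * transpose_mat (boundary_mat n k S)"

text \<open>
  Eigenvalues are listed with multiplicity in weakly decreasing order. The Laplacian is a real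
  symmetric matrix, so its characteristic polynomial splits over the reals and the list has
  length \<open>n choose (k - 1)\<close>.
\<close>

definition laplacian_spectrum :: "nat \<Rightarrow> nat \<Rightarrow> nat set set \<Rightarrow> real list" where
  "laplacian_spectrum n k S =
     rev (sorted_list_of_multiset (proots (char_poly (laplacian n k S))))"

text \<open>Indices are 1-based; beyond the length of the spectrum the eigenvalue is \<open>0\<close>.\<close>

definition laplacian_eigenvalue :: "nat \<Rightarrow> nat \<Rightarrow> nat set set \<Rightarrow> nat \<Rightarrow> real" where
  "laplacian_eigenvalue n k S i =
     (if 1 \<le> i \<and> i \<le> length (laplacian_spectrum n k S)
      then laplacian_spectrum n k S ! (i - 1) else 0)"

end

theory Submission
  imports Defs
begin

text \<open>
  Let \<open>v\<close> be the first vertex in the order witnessing shiftedness, with link \<open>K\<close> and deletion \<open>D\<close>.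
  Every face of a facet of \<open>D\<close> lies in \<open>K\<close>, and \<open>\<partial>\<partial> = 0\<close> gives
  \<open>\<partial>\<^sup>T \<partial> = E\<^sup>T (I + M) E\<close>, where \<open>E\<close> consists of the rows of the boundary matrix
  indexed by \<open>K\<close> and \<open>M = \<partial>\<^sup>T \<partial>\<close> for \<open>K\<close>. Moreover \<open>E E\<^sup>T = I + L\<close> with \<open>L = L(D)\<close> restricted to
  the rows in \<open>K\<close>, and \<open>M L = 0\<close>. Hence the nonzero spectrum of \<open>S\<close> is that of
  \<open>I + M + L\<close>, a matrix of size \<open>|K|\<close>, so it arises from the nonzero eigenvalues of \<open>K\<close> and
  \<open>D\<close>, padded by zeros, by adding \<open>1\<close> to each. The bound, stated for all submultisets of the
  nonzero spectrum, then follows by induction from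
  \<open>(a+k-2 choose k-1) + (b+k-1 choose k) \<le> (a+b+k-1 choose k)\<close>; for \<open>k = 2\<close> the link is a set of
  \<open>m\<close> points, whose only nonzero eigenvalue is \<open>m\<close>. Working with roots of characteristic polynomials
  makes the spectral theorem unnecessary. The apex \<open>v\<close> need not be the least vertex in the
  order fixing the signs of the boundary matrix, so no relabelling is needed.
\<close>

section \<open>Nonzero roots of characteristic polynomials\<close>

lemma poly_char_poly:
  fixes A :: "'a :: field mat"
  assumes A: "A \<in> carrier_mat n n"
  shows "poly (char_poly A) x = det (x \<cdot>\<^sub>m 1\<^sub>m n - A)"
proof -
  have "- char_matrix A x = x \<cdot>\<^sub>m 1\<^sub>m n - A"
    using A by (intro eq_matI) (auto simp: char_matrix_def)
  then show ?thesis
    unfolding char_poly_matrix[OF A] by simp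
qed

text \<open>Sylvester's identity: the determinant of the block matrix with rows
  \<open>(x I, A)\<close> and \<open>(B, I)\<close> is computed twice, clearing \<open>A\<close>
  once from the left and once from the right.\<close>

lemma char_poly_mult_commute:
  fixes A B :: "real mat"
  assumes A: "A \<in> carrier_mat n m" and B: "B \<in> carrier_mat m n"
  shows "monom 1 m * char_poly (A * B) = monom 1 n * char_poly (B * A)"
proof -
  have "x ^ m * poly (char_poly (A * B)) x = x ^ n * poly (char_poly (B * A)) x" for x
  proof -
    let ?P = "four_block_mat (1\<^sub>m n) (- A) (0\<^sub>m m n) (1\<^sub>m m)"
    let ?Q = "four_block_mat (x \<cdot>\<^sub>m 1\<^sub>m n) A B (1\<^sub>m m)"
    let ?R = "four_block_mat (1\<^sub>m n) (- A) (0\<^sub>m m n) (x \<cdot>\<^sub>m 1\<^sub>m m)"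
    have AB: "A * B \<in> carrier_mat n n" and BA: "B * A \<in> carrier_mat m m"
      using A B by auto
    have "1\<^sub>m n * (x \<cdot>\<^sub>m 1\<^sub>m n) + - A * B = x \<cdot>\<^sub>m 1\<^sub>m n - A * B"
      using A B by (intro eq_matI) auto
    then have "?P * ?Q = four_block_mat (x \<cdot>\<^sub>m 1\<^sub>m n - A * B) (0\<^sub>m n m) B (1\<^sub>m m)"
      using A B by (subst mult_four_block_mat[where ?nr1.0 = n and ?n1.0 = n and ?n2.0 = m
            and ?nr2.0 = m and ?nc1.0 = n and ?nc2.0 = m]) auto
    moreover have "det ?P = 1"
      using A by (subst det_four_block_mat_lower_left_zero[of _ n _ m]) auto
    moreover have "det (?P * ?Q) = det ?P * det ?Q"
      using A B by (intro det_mult[of _ "n + m"]) auto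
    moreover have "det (four_block_mat (x \<cdot>\<^sub>m 1\<^sub>m n - A * B) (0\<^sub>m n m) B (1\<^sub>m m))
        = det (x \<cdot>\<^sub>m 1\<^sub>m n - A * B)"
      using A B AB by (subst det_four_block_mat_upper_right_zero[of _ n _ m]) auto
    ultimately have 1: "det ?Q = det (x \<cdot>\<^sub>m 1\<^sub>m n - A * B)"
      by simp
    \<comment> \<open>Here \<open>A\<close> is cancelled against \<open>x I\<close>. To avoid
      dividing by \<open>x\<close>, \<open>?R\<close> has \<open>x I\<close> as its lower block, at
      the cost of a factor \<open>x ^ m\<close>.\<close>
    have "x \<cdot>\<^sub>m 1\<^sub>m n * - A + A * (x \<cdot>\<^sub>m 1\<^sub>m m) = 0\<^sub>m n m"
      using A by (intro eq_matI)
        (auto simp: mult_smult_assoc_mat[of _ n n _ m] mult_smult_distrib[OF A, of _ m])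
    moreover have "B * - A + 1\<^sub>m m * (x \<cdot>\<^sub>m 1\<^sub>m m) = x \<cdot>\<^sub>m 1\<^sub>m m - B * A"
      using A B by (intro eq_matI) auto
    ultimately have "?Q * ?R = four_block_mat (x \<cdot>\<^sub>m 1\<^sub>m n) (0\<^sub>m n m) B (x \<cdot>\<^sub>m 1\<^sub>m m - B * A)"
      using A B by (subst mult_four_block_mat[where ?nr1.0 = n and ?n1.0 = n and ?n2.0 = m
            and ?nr2.0 = m and ?nc1.0 = n and ?nc2.0 = m]) auto
    moreover have "det ?R = x ^ m"
      using A by (subst det_four_block_mat_lower_left_zero[of _ n _ m]) (auto simp: det_smult)
    moreover have "det (?Q * ?R) = det ?Q * det ?R"
      using A B by (intro det_mult[of _ "n + m"]) auto
    moreover have "det (four_block_mat (x \<cdot>\<^sub>m 1\<^sub>m n) (0\<^sub>m n m) B (x \<cdot>\<^sub>m 1\<^sub>m m - B * A))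
        = x ^ n * det (x \<cdot>\<^sub>m 1\<^sub>m m - B * A)"
      using A B BA by (subst det_four_block_mat_upper_right_zero[of _ n _ m]) (auto simp: det_smult)
    ultimately have "det (x \<cdot>\<^sub>m 1\<^sub>m n - A * B) * x ^ m = x ^ n * det (x \<cdot>\<^sub>m 1\<^sub>m m - B * A)"
      using 1 by simp
    then show ?thesis
      by (simp add: poly_char_poly[OF AB] poly_char_poly[OF BA] mult.commute)
  qed
  then show ?thesis
    by (intro poly_ext) (simp add: poly_monom)
qed

text \<open>\<open>P * Q = 0\<close> gives \<open>(x I - P) (x I - Q) = x (x I - (P + Q))\<close>;
  determinants are then taken.\<close>

lemma char_poly_add_orthogonal:
  fixes P Q :: "real mat"
  assumes P: "P \<in> carrier_mat m m" and Q: "Q \<in> carrier_mat m m" and PQ: "P * Q = 0\<^sub>m m m"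
  shows "monom 1 m * char_poly (P + Q) = char_poly P * char_poly Q"
proof -
  have "x ^ m * poly (char_poly (P + Q)) x = poly (char_poly P) x * poly (char_poly Q) x" for x
  proof -
    let ?X = "x \<cdot>\<^sub>m 1\<^sub>m m"
    have "(?X - P) * (?X - Q) = (?X - P) * ?X - (?X - P) * Q"
      using P Q by (intro mult_minus_distrib_mat) auto
    also have "\<dots> = (?X * ?X - P * ?X) - (?X * Q - P * Q)"
      using P Q minus_mult_distrib_mat[of ?X m m P ?X m] minus_mult_distrib_mat[of ?X m m P Q m]
      by auto
    also have "\<dots> = x \<cdot>\<^sub>m (?X - (P + Q))"
      using P Q by (intro eq_matI) (auto simp: PQ algebra_simps mult_smult_distrib[OF P])
    finally have "det (?X - P) * det (?X - Q) = x ^ m * det (?X - (P + Q))"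
      using P Q det_mult[of "?X - P" m "?X - Q"] by (simp add: det_smult minus_carrier_mat)
    then show ?thesis
      using P Q by (simp add: poly_char_poly[of _ m])
  qed
  then show ?thesis
    by (intro poly_ext) (simp add: poly_monom)
qed

lemma char_poly_one_add:
  fixes Q :: "real mat"
  assumes Q: "Q \<in> carrier_mat m m"
  shows "char_poly (1\<^sub>m m + Q) = pcompose (char_poly Q) [:-1, 1:]"
proof (rule poly_ext)
  fix x :: real
  have "x \<cdot>\<^sub>m 1\<^sub>m m - (1\<^sub>m m + Q) = (x - 1) \<cdot>\<^sub>m 1\<^sub>m m - Q"
    using Q by (intro eq_matI) auto
  then show "poly (char_poly (1\<^sub>m m + Q)) x = poly (pcompose (char_poly Q) [:-1, 1:]) x"
    using Q by (simp add: poly_char_poly[of _ m] poly_pcompose)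
qed

section \<open>Roots and multiplicities under translation of the variable\<close>

lemma pcompose_power:
  fixes p :: "'a :: comm_ring_1 poly"
  shows "pcompose (p ^ n) q = pcompose p q ^ n"
  by (induction n) (simp_all add: pcompose_mult pcompose_1)

lemma pcompose_linear_inverse:
  fixes p :: "'a :: comm_ring_1 poly"
  shows "pcompose (pcompose p [:- c, 1:]) [:c, 1:] = p"
  by (simp add: pcompose_assoc[symmetric] pcompose_pCons pcompose_idR)

text \<open>Substituting \<open>X - c\<close> is a ring automorphism with inverse
  \<open>X + c\<close>, so divisibility passes in both directions. This controls multiplicities of
  roots.\<close>

lemma linear_power_dvd_pcompose_iff:
  fixes p :: "'a :: idom poly"
  shows "[:- (a + c), 1:] ^ n dvd pcompose p [:- c, 1:] \<longleftrightarrow> [:- a, 1:] ^ n dvd p"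
proof
  assume "[:- a, 1:] ^ n dvd p"
  then obtain q where q: "p = [:- a, 1:] ^ n * q" ..
  have "pcompose [:- a, 1:] [:- c, 1:] = [:- (a + c), 1:]"
    by (simp add: pcompose_pCons)
  then show "[:- (a + c), 1:] ^ n dvd pcompose p [:- c, 1:]"
    unfolding q pcompose_mult pcompose_power by simp
next
  assume "[:- (a + c), 1:] ^ n dvd pcompose p [:- c, 1:]"
  then obtain q where q: "pcompose p [:- c, 1:] = [:- (a + c), 1:] ^ n * q" ..
  have "p = pcompose (pcompose p [:- c, 1:]) [:c, 1:]"
    by (simp add: pcompose_linear_inverse)
  also have "\<dots> = pcompose [:- (a + c), 1:] [:c, 1:] ^ n * pcompose q [:c, 1:]"
    unfolding q pcompose_mult pcompose_power ..
  also have "pcompose [:- (a + c), 1:] [:c, 1:] = [:- a, 1:]"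
    by (simp add: pcompose_pCons)
  finally show "[:- a, 1:] ^ n dvd p"
    by (metis dvd_triv_left)
qed

lemma proots_pcompose_linear:
  fixes p :: "'a :: idom poly"
  assumes "p \<noteq> 0"
  shows "proots (pcompose p [:- c, 1:]) = image_mset (\<lambda>x. x + c) (proots p)"
proof (rule multiset_eqI)
  fix x
  have *: "pcompose p [:- c, 1:] \<noteq> 0"
    using assms pcompose_linear_inverse[of p c] by auto
  have shift: "count (image_mset (\<lambda>x. x + c) M) x = count M (x - c)" for M
    by (induction M) (auto simp: algebra_simps)
  have "order (x - c) p = order x (pcompose p [:- c, 1:])"
    using order[OF *, of x] order_unique_lemma[of "x - c" "order x (pcompose p [:- c, 1:])" p]
      linear_power_dvd_pcompose_iff[of "x - c" c _ p] assms
    by (simp only: diff_add_cancel simp_thms)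
  then show "count (proots (pcompose p [:- c, 1:])) x
      = count (image_mset (\<lambda>x. x + c) (proots p)) x"
    using * assms by (simp add: shift)
qed

lemma char_poly_nonzero:
  fixes A :: "'a :: comm_ring_1 mat"
  assumes "A \<in> carrier_mat n n"
  shows "char_poly A \<noteq> 0"
  using degree_monic_char_poly[OF assms] by auto

text \<open>Zero is left out because the spectra of \<open>A * B\<close> and \<open>B * A\<close>
  agree only up to zeros. Multiplicities are algebraic, and only real roots are counted.\<close>

definition nonzero_eigenvalues :: "real mat \<Rightarrow> real multiset" where
  "nonzero_eigenvalues A = filter_mset (\<lambda>x. x \<noteq> 0) (proots (char_poly A))"

lemma filter_proots_monom_mult:
  fixes p :: "'a :: idom poly"
  assumes "p \<noteq> 0"
  shows "filter_mset (\<lambda>x. x \<noteq> 0) (proots (monom 1 m * p)) = filter_mset (\<lambda>x. x \<noteq> 0) (proots p)"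
proof -
  have "monom (1 :: 'a) m = [:0, 1:] ^ m"
    by (simp add: monom_altdef)
  then have "proots (monom (1 :: 'a) m) = repeat_mset m {#0#}"
    using proots_linear_factor[of "0 :: 'a"] by (simp add: proots_power)
  then have "filter_mset (\<lambda>x. x \<noteq> 0) (proots (monom (1 :: 'a) m)) = {#}"
    by (intro multiset_eqI) (simp add: count_filter_mset)
  then show ?thesis
    using assms by (simp add: proots_mult)
qed

lemma nonzero_eigenvalues_mult_commute:
  assumes A: "A \<in> carrier_mat n m" and B: "B \<in> carrier_mat m n"
  shows "nonzero_eigenvalues (A * B) = nonzero_eigenvalues (B * A)"
proof -
  have nz: "char_poly (A * B) \<noteq> 0" "char_poly (B * A) \<noteq> 0"
    using char_poly_nonzero[OF mult_carrier_mat[OF A B]] char_poly_nonzero[OF mult_carrier_mat[OF B A]]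
    by auto
  show ?thesis
    unfolding nonzero_eigenvalues_def filter_proots_monom_mult[OF nz(1), of m, symmetric]
      filter_proots_monom_mult[OF nz(2), of n, symmetric] char_poly_mult_commute[OF A B] ..
qed

lemma nonzero_eigenvalues_add_orthogonal:
  assumes P: "P \<in> carrier_mat m m" and Q: "Q \<in> carrier_mat m m" and PQ: "P * Q = 0\<^sub>m m m"
  shows "nonzero_eigenvalues (P + Q) = nonzero_eigenvalues P + nonzero_eigenvalues Q"
proof -
  have nz: "char_poly (P + Q) \<noteq> 0" "char_poly P \<noteq> 0" "char_poly Q \<noteq> 0"
    using char_poly_nonzero[OF P] char_poly_nonzero[OF Q] char_poly_nonzero[OF add_carrier_mat[OF Q]]
    by auto
  have "nonzero_eigenvalues (P + Q)
      = filter_mset (\<lambda>x. x \<noteq> 0) (proots (monom 1 m * char_poly (P + Q)))"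
    unfolding nonzero_eigenvalues_def filter_proots_monom_mult[OF nz(1)] ..
  then show ?thesis
    unfolding char_poly_add_orthogonal[OF assms] nonzero_eigenvalues_def
    using nz by (simp add: proots_mult)
qed

section \<open>Matrices indexed by lists\<close>

definition indexed_mat :: "'a list \<Rightarrow> 'b list \<Rightarrow> ('a \<Rightarrow> 'b \<Rightarrow> 'c) \<Rightarrow> 'c mat" where
  "indexed_mat xs ys f = mat (length xs) (length ys) (\<lambda>(i, j). f (xs ! i) (ys ! j))"

lemma indexed_mat_carrier [simp]: "indexed_mat xs ys f \<in> carrier_mat (length xs) (length ys)"
  by (simp add: indexed_mat_def)

lemma indexed_mat_cong:
  assumes "\<And>x y. x \<in> set xs \<Longrightarrow> y \<in> set ys \<Longrightarrow> f x y = g x y"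
  shows "indexed_mat xs ys f = indexed_mat xs ys g"
  unfolding indexed_mat_def by (intro eq_matI) (auto simp: assms)

lemma indexed_mat_mult:
  fixes f :: "'a \<Rightarrow> 'b \<Rightarrow> 'd :: comm_semiring_0"
  assumes "distinct ys"
  shows "indexed_mat xs ys f * indexed_mat ys zs g
    = indexed_mat xs zs (\<lambda>x z. \<Sum>y\<in>set ys. f x y * g y z)"
proof -
  have "(\<Sum>y\<in>set ys. h y) = (\<Sum>i = 0..<length ys. h (ys ! i))" for h :: "'b \<Rightarrow> 'd"
    using sum.reindex_bij_betw[OF bij_betw_nth[OF assms refl refl], of h]
    by (simp add: atLeast0LessThan)
  then show ?thesis
    unfolding indexed_mat_def by (intro eq_matI) (auto simp: scalar_prod_def)
qed

lemma indexed_mat_transpose: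
  "transpose_mat (indexed_mat xs ys f) = indexed_mat ys xs (\<lambda>y x. f x y)"
  unfolding indexed_mat_def by (intro eq_matI) auto

lemma indexed_mat_add:
  "indexed_mat xs ys f + indexed_mat xs ys g = indexed_mat xs ys (\<lambda>x y. f x y + g x y)"
  unfolding indexed_mat_def by (intro eq_matI) auto

lemma indexed_mat_zero: "indexed_mat xs ys (\<lambda>x y. 0) = 0\<^sub>m (length xs) (length ys)"
  unfolding indexed_mat_def by (intro eq_matI) auto

lemma indexed_mat_one:
  assumes "distinct xs"
  shows "indexed_mat xs xs (\<lambda>x y. if x = y then 1 else 0) = 1\<^sub>m (length xs)"
  unfolding indexed_mat_def using assms by (intro eq_matI) (auto simp: nth_eq_iff_index_eq)

section \<open>Boundary coefficients and Gram matrices\<close>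

text \<open>For \<open>v \<in> F\<close> the exponent is the zero-based position of \<open>v\<close>
  in increasing order: the usual boundary sign without a sorted list.\<close>

definition position_sign :: "nat set \<Rightarrow> nat \<Rightarrow> real" where
  "position_sign F v = (- 1) ^ card {u \<in> F. u < v}"

text \<open>The coefficient of \<open>G\<close> in the boundary of \<open>F\<close>. At most one
  summand is nonzero; the sum form lets summations be exchanged.\<close>

definition incidence :: "nat set \<Rightarrow> nat set \<Rightarrow> real" where
  "incidence G F = (\<Sum>v\<in>F. if G = F - {v} then position_sign F v else 0)"

lemma position_sign_square: "position_sign F v * position_sign F v = 1"
  by (simp add: position_sign_def power_mult_distrib[symmetric])

text \<open>Deleting \<open>v\<close> moves exactly the later vertices down by one place.\<close>

lemma position_sign_remove:
  assumes "finite F" "v \<in> F"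
  shows "position_sign (F - {v}) w = (if v < w then - position_sign F w else position_sign F w)"
proof (cases "v < w")
  case True
  have "{u \<in> F. u < w} = insert v {u \<in> F - {v}. u < w}"
    using assms True by auto
  then have "card {u \<in> F. u < w} = Suc (card {u \<in> F - {v}. u < w})"
    using assms by simp
  then show ?thesis
    using True by (simp add: position_sign_def)
next
  case False
  then have "{u \<in> F - {v}. u < w} = {u \<in> F. u < w}"
    by auto
  then show ?thesis
    using False by (simp add: position_sign_def)
qed

lemma incidence_eq_0: "(\<And>v. v \<in> F \<Longrightarrow> G \<noteq> F - {v}) \<Longrightarrow> incidence G F = 0"
  unfolding incidence_def by (intro sum.neutral) auto

lemma incidence_remove:
  assumes "finite F" "v \<in> F"
  shows "incidence (F - {v}) F = position_sign F v"
proof -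
  have "incidence (F - {v}) F = (\<Sum>w\<in>F. if v = w then position_sign F w else 0)"
    unfolding incidence_def using assms by (intro sum.cong) auto
  then show ?thesis
    using assms by simp
qed

lemma sum_incidence:
  assumes "finite R" "finite F" "\<And>v. v \<in> F \<Longrightarrow> F - {v} \<in> R"
  shows "(\<Sum>G\<in>R. incidence G F * g G) = (\<Sum>v\<in>F. position_sign F v * g (F - {v}))"
proof -
  have "(\<Sum>G\<in>R. incidence G F * g G)
      = (\<Sum>v\<in>F. \<Sum>G\<in>R. if G = F - {v} then position_sign F v * g G else 0)"
    unfolding incidence_def sum_distrib_right by (subst sum.swap) (auto intro!: sum.cong)
  also have "\<dots> = (\<Sum>v\<in>F. position_sign F v * g (F - {v}))"
    using assms by (intro sum.cong) auto
  finally show ?thesis .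
qed

text \<open>Removing two vertices in either order gives the same face with opposite signs.
  \<open>R\<close> may be any finite set containing the faces \<open>F - {v}\<close>.\<close>

lemma boundary_boundary:
  assumes "finite R" "finite F" "\<And>v. v \<in> F \<Longrightarrow> F - {v} \<in> R"
  shows "(\<Sum>H\<in>R. incidence G H * incidence H F) = 0"
proof -
  \<comment> \<open>Contribution of removing \<open>v\<close> first and then \<open>w\<close>, set
    to zero for \<open>v = w\<close> so that both indices range over all of
    \<open>F\<close>.\<close>
  define a where "a v w = (if v \<noteq> w \<and> G = F - {v} - {w}
      then position_sign F v * position_sign (F - {v}) w else 0)" for v w
  have a: "a w v = - a v w" if "v \<in> F" "w \<in> F" for v w
  proof -
    have "F - {w} - {v} = F - {v} - {w}"
      by auto
    then show ?thesis
      using that assms(2) by (auto simp: a_def position_sign_remove)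
  qed
  have "(\<Sum>H\<in>R. incidence G H * incidence H F)
      = (\<Sum>v\<in>F. position_sign F v * incidence G (F - {v}))"
    using sum_incidence[OF assms, of "incidence G"] by (simp add: mult.commute)
  also have "\<dots> = (\<Sum>v\<in>F. \<Sum>w\<in>F. a v w)"
  proof (intro sum.cong refl)
    fix v assume "v \<in> F"
    have "(\<Sum>w\<in>F. a v w) = (\<Sum>w\<in>F - {v}. a v w)"
      using assms(2) by (intro sum.mono_neutral_right) (auto simp: a_def)
    also have "\<dots> = position_sign F v * incidence G (F - {v})"
      unfolding incidence_def sum_distrib_left by (intro sum.cong) (auto simp: a_def)
    finally show "position_sign F v * incidence G (F - {v}) = (\<Sum>w\<in>F. a v w)" ..
  qed
  also have "(\<Sum>v\<in>F. \<Sum>w\<in>F. a v w) = 0"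
  proof -
    have "(\<Sum>v\<in>F. \<Sum>w\<in>F. a v w) = (\<Sum>v\<in>F. \<Sum>w\<in>F. a w v)"
      by (rule sum.swap)
    also have "\<dots> = (\<Sum>v\<in>F. \<Sum>w\<in>F. - a v w)"
      by (intro sum.cong refl a)
    finally show ?thesis
      by (simp add: sum_negf)
  qed
  finally show ?thesis .
qed

text \<open>With \<open>\<partial>\<close> the incidence matrix, this is
  \<open>\<partial> \<partial>^T\<close>, and \<open>col_gram\<close> is
  \<open>\<partial>^T \<partial>\<close>. Only the indices that survive in the product need a list;
  the summed side is a plain set.\<close>

definition row_gram :: "nat set list \<Rightarrow> nat set set \<Rightarrow> real mat" where
  "row_gram rs S = indexed_mat rs rs (\<lambda>G G'. \<Sum>F\<in>S. incidence G F * incidence G' F)"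

definition col_gram :: "nat set set \<Rightarrow> nat set list \<Rightarrow> real mat" where
  "col_gram R cs = indexed_mat cs cs (\<lambda>F F'. \<Sum>G\<in>R. incidence G F * incidence G F')"

lemma row_gram_carrier [simp]: "row_gram rs S \<in> carrier_mat (length rs) (length rs)"
  by (simp add: row_gram_def)

lemma col_gram_carrier [simp]: "col_gram R cs \<in> carrier_mat (length cs) (length cs)"
  by (simp add: col_gram_def)

lemma row_gram_eq:
  assumes "distinct cs"
  shows "row_gram rs (set cs) = indexed_mat rs cs incidence * transpose_mat (indexed_mat rs cs incidence)"
  unfolding row_gram_def indexed_mat_transpose indexed_mat_mult[OF assms] ..

lemma col_gram_eq:
  assumes "distinct rs"
  shows "col_gram (set rs) cs = transpose_mat (indexed_mat rs cs incidence) * indexed_mat rs cs incidence"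
  unfolding col_gram_def indexed_mat_transpose indexed_mat_mult[OF assms] ..

text \<open>Rows that are not faces of a column vanish, so any finite row set containing all faces
  gives the same matrix. The whole power set may serve, whatever the dimension.\<close>

lemma col_gram_cong:
  assumes "finite R" "finite R'" "\<And>F v. F \<in> set cs \<Longrightarrow> v \<in> F \<Longrightarrow> F - {v} \<in> R \<inter> R'"
  shows "col_gram R cs = col_gram R' cs"
  unfolding col_gram_def
proof (rule indexed_mat_cong)
  fix F F' assume F: "F \<in> set cs" "F' \<in> set cs"
  have *: "incidence G F = 0" if "G \<notin> R \<inter> R'" for G
    using that assms(3)[OF F(1)] by (intro incidence_eq_0) blast
  have "(\<Sum>G\<in>R. incidence G F * incidence G F') = (\<Sum>G\<in>R \<inter> R'. incidence G F * incidence G F')"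
    using assms * by (intro sum.mono_neutral_right) auto
  also have "\<dots> = (\<Sum>G\<in>R'. incidence G F * incidence G F')"
    using assms * by (intro sum.mono_neutral_left) auto
  finally show "(\<Sum>G\<in>R. incidence G F * incidence G F') = (\<Sum>G\<in>R'. incidence G F * incidence G F')" .
qed

lemma nonzero_eigenvalues_row_gram:
  assumes "distinct rs" "distinct cs" "finite R"
    and "\<And>F v. F \<in> set cs \<Longrightarrow> v \<in> F \<Longrightarrow> F - {v} \<in> set rs \<inter> R"
  shows "nonzero_eigenvalues (row_gram rs (set cs)) = nonzero_eigenvalues (col_gram R cs)"
proof -
  have "col_gram R cs = col_gram (set rs) cs"
    using assms by (intro col_gram_cong) auto
  then show ?thesis
    unfolding row_gram_eq[OF assms(2)] col_gram_eq[OF assms(1)]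
    using nonzero_eigenvalues_mult_commute[of "indexed_mat rs cs incidence" "length rs" "length cs"]
    by (metis indexed_mat_carrier transpose_carrier_mat)
qed

section \<open>The recursion for near-cones\<close>

text \<open>Here \<open>cs\<close> lists the facets, \<open>ls\<close> the link and
  \<open>ds\<close> the deletion of \<open>v\<close>. The zeros in \<open>A\<close> matter, since
  each becomes an eigenvalue 1; \<open>size A\<close> bounds how many ones are added in
  total.\<close>

lemma near_cone_spectrum:
  assumes V: "finite V" "v \<in> V" and dist: "distinct cs" "distinct ls" "distinct ds"
    and cs: "set cs \<subseteq> Pow V"
    and ls: "set ls = {H. v \<notin> H \<and> insert v H \<in> set cs}"
    and ds: "set ds = {F \<in> set cs. v \<notin> F}"
    and near: "\<And>F w. F \<in> set ds \<Longrightarrow> w \<in> F \<Longrightarrow> F - {w} \<in> set ls"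
  shows "\<exists>A. size A \<le> length ls
    \<and> filter_mset (\<lambda>x. x \<noteq> 0) A = nonzero_eigenvalues (col_gram (Pow (V - {v})) ds)
        + nonzero_eigenvalues (col_gram (Pow (V - {v})) ls)
    \<and> nonzero_eigenvalues (col_gram (Pow V) cs)
        = filter_mset (\<lambda>x. x \<noteq> 0) (image_mset (\<lambda>x. x + 1) A)"
proof -
  let ?l = "length ls" and ?W = "V - {v}"
  define E where "E = indexed_mat ls cs incidence"
  define L where "L = row_gram ls (set ds)"
  define N where "N = col_gram (Pow ?W) ls"
  have E: "E \<in> carrier_mat ?l (length cs)" and L: "L \<in> carrier_mat ?l ?l"
    and N: "N \<in> carrier_mat ?l ?l"
    by (simp_all add: E_def L_def N_def)
  have finV: "finite F" if "F \<in> Pow V" for F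
    using that V(1) finite_subset by auto
  have lsW: "set ls \<subseteq> Pow ?W"
    using ls cs by auto
  have dsW: "set ds \<subseteq> Pow ?W"
    using ds cs by auto
  \<comment> \<open>A face avoiding \<open>v\<close> arises by deleting \<open>v\<close>, and then
    lies in the link by definition, or from a member of \<open>ds\<close>, and then
    \<open>near\<close> applies.\<close>
  have inc_ls: "incidence H F = 0" if "F \<in> set cs" "v \<notin> H" "H \<notin> set ls" for H F
  proof (rule incidence_eq_0)
    fix w assume "w \<in> F"
    show "H \<noteq> F - {w}"
    proof (cases "w = v")
      case True
      show ?thesis
      proof
        assume "H = F - {w}"
        then have "insert v H = F"
          using True \<open>w \<in> F\<close> by auto
        then show False
          using that ls by simp
      qed
    next
      case False
      show ?thesis
      proof
        assume H: "H = F - {w}"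
        then have "F \<in> set ds"
          using that ds False by simp
        then show False
          using H near \<open>w \<in> F\<close> that by simp
      qed
    qed
  qed
  have inc_v: "incidence H F = (if F = insert v H then position_sign F v else 0)"
    if "F \<in> Pow V" "v \<in> F" "v \<notin> H" for H F
  proof (cases "F = insert v H")
    case True
    then show ?thesis
      using that incidence_remove[OF finV, of F v] by auto
  next
    case False
    then show ?thesis
      using that by (auto intro!: incidence_eq_0)
  qed
  \<comment> \<open>Evaluating \<open>\<partial>\<partial> = 0\<close> at a face avoiding \<open>v\<close> expresses the part of \<open>\<partial>F\<close> through \<open>v\<close> by the part
    avoiding \<open>v\<close>.\<close>
  have inc_cone: "incidence (insert v G) F * incidence (insert v G) F'
      = (\<Sum>H\<in>set ls. incidence G H * incidence H F) * (\<Sum>H\<in>set ls. incidence G H * incidence H F')"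
    if "G \<in> Pow ?W" "F \<in> set cs" "F' \<in> set cs" for G F F'
  proof -
    have *: "position_sign (insert v G) v * incidence (insert v G) F
        = - (\<Sum>H\<in>set ls. incidence G H * incidence H F)" if F: "F \<in> set cs" for F
    proof -
      have "0 = (\<Sum>H\<in>Pow V. incidence G H * incidence H F)"
        using F cs V finV by (intro boundary_boundary[symmetric]) auto
      also have "\<dots> = (\<Sum>H\<in>Pow V - Pow ?W. incidence G H * incidence H F)
          + (\<Sum>H\<in>Pow ?W. incidence G H * incidence H F)"
        using V by (intro sum.subset_diff) auto
      also have "(\<Sum>H\<in>Pow ?W. incidence G H * incidence H F)
          = (\<Sum>H\<in>set ls. incidence G H * incidence H F)"
        using V lsW F inc_ls by (intro sum.mono_neutral_right) auto
      also have "(\<Sum>H\<in>Pow V - Pow ?W. incidence G H * incidence H F)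
          = (\<Sum>H\<in>{insert v G}. incidence G H * incidence H F)"
      proof (rule sum.mono_neutral_right)
        show "finite (Pow V - Pow ?W)" "{insert v G} \<subseteq> Pow V - Pow ?W"
          using V \<open>G \<in> Pow ?W\<close> by auto
        show "\<forall>H\<in>Pow V - Pow ?W - {insert v G}. incidence G H * incidence H F = 0"
        proof
          fix H assume "H \<in> Pow V - Pow ?W - {insert v G}"
          then show "incidence G H * incidence H F = 0"
            using inc_v[of H G] \<open>G \<in> Pow ?W\<close> by (simp add: subset_Diff_insert)
        qed
      qed
      also have "\<dots> = position_sign (insert v G) v * incidence (insert v G) F"
        using inc_v[of "insert v G" G] \<open>G \<in> Pow ?W\<close> V by auto
      finally show ?thesis
        by simp
    qed
    have "incidence (insert v G) F * incidence (insert v G) F'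
        = (position_sign (insert v G) v * incidence (insert v G) F)
          * (position_sign (insert v G) v * incidence (insert v G) F')"
      using position_sign_square[of "insert v G" v] by (simp add: algebra_simps)
    then show ?thesis
      using *[OF that(2)] *[OF that(3)] by simp
  qed
  obtain gs where gs: "set gs = Pow ?W" "distinct gs"
    using V finite_distinct_list[of "Pow ?W"] by auto
  define D where "D = indexed_mat gs ls incidence"
  have D: "D \<in> carrier_mat (length gs) ?l"
    by (simp add: D_def)
  have N_eq: "N = transpose_mat D * D"
    unfolding N_def D_def gs(1)[symmetric] by (rule col_gram_eq[OF gs(2)])
  \<comment> \<open>\<open>D\<close> times the boundary matrix of \<open>ds\<close> is a composite
    of two boundary maps; \<open>near\<close> ensures that no face of \<open>ds\<close> is missing
    from \<open>ls\<close>.\<close>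
  have NL: "N * L = 0\<^sub>m ?l ?l"
  proof -
    have "D * indexed_mat ls ds incidence = 0\<^sub>m (length gs) (length ds)"
      unfolding D_def indexed_mat_mult[OF dist(2)] indexed_mat_zero[symmetric]
    proof (rule indexed_mat_cong)
      fix G F assume F: "F \<in> set ds"
      show "(\<Sum>H\<in>set ls. incidence G H * incidence H F) = 0"
        using F near finV[of F] dsW by (intro boundary_boundary) auto
    qed
    then have DL: "D * L = 0\<^sub>m (length gs) ?l"
      unfolding L_def row_gram_eq[OF dist(3)]
      using D by (simp add: assoc_mult_mat[of D "length gs" ?l _ "length ds" _ ?l, symmetric]
          left_mult_zero_mat[of _ "length ds" ?l])
    then show ?thesis
      unfolding N_eq using D L
      by (simp add: assoc_mult_mat[of _ ?l "length gs" _ ?l _ ?l]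
          right_mult_zero_mat[of _ ?l "length gs"])
  qed
  have prod: "(1\<^sub>m ?l + N) * (1\<^sub>m ?l + L) = 1\<^sub>m ?l + (N + L)"
  proof -
    have "(1\<^sub>m ?l + N) * (1\<^sub>m ?l + L) = (1\<^sub>m ?l + N) * 1\<^sub>m ?l + (1\<^sub>m ?l + N) * L"
      using N L by (intro mult_add_distrib_mat) auto
    also have "(1\<^sub>m ?l + N) * L = L"
      using N L NL by (simp add: add_mult_distrib_mat[of _ ?l ?l])
    finally show ?thesis
      using N L by auto
  qed
  \<comment> \<open>Rows are split by whether they contain \<open>v\<close>. Those avoiding it give
    \<open>E^T E\<close>; those containing it give the Gram matrix of \<open>D * E\<close> through
    \<open>inc_cone\<close>.\<close>
  have "col_gram (Pow V) cs = transpose_mat E * E + transpose_mat (D * E) * (D * E)"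
    unfolding E_def D_def indexed_mat_mult[OF dist(2)] indexed_mat_transpose
      indexed_mat_mult[OF gs(2)] indexed_mat_add col_gram_def
  proof (rule indexed_mat_cong)
    fix F F' assume F: "F \<in> set cs" "F' \<in> set cs"
    let ?f = "\<lambda>G. incidence G F * incidence G F'"
    have "(\<Sum>G\<in>Pow V. ?f G) = (\<Sum>G\<in>Pow V - Pow ?W. ?f G) + (\<Sum>G\<in>Pow ?W. ?f G)"
      using V by (intro sum.subset_diff) auto
    also have "(\<Sum>G\<in>Pow ?W. ?f G) = (\<Sum>G\<in>set ls. ?f G)"
      using V lsW F inc_ls by (intro sum.mono_neutral_right) auto
    also have "(\<Sum>G\<in>Pow V - Pow ?W. ?f G) = (\<Sum>G\<in>Pow ?W. ?f (insert v G))"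
      by (rule sum.reindex_bij_witness[of _ "insert v" "\<lambda>G. G - {v}"]) (use V in \<open>auto simp: insert_absorb\<close>)
    also have "\<dots> = (\<Sum>G\<in>set gs. (\<Sum>H\<in>set ls. incidence G H * incidence H F)
        * (\<Sum>H\<in>set ls. incidence G H * incidence H F'))"
      unfolding gs(1) using inc_cone F by (intro sum.cong) auto
    finally show "(\<Sum>G\<in>Pow V. ?f G) = (\<Sum>G\<in>set ls. ?f G)
        + (\<Sum>G\<in>set gs. (\<Sum>H\<in>set ls. incidence G H * incidence H F)
        * (\<Sum>H\<in>set ls. incidence G H * incidence H F'))"
      by simp
  qed
  also have "\<dots> = transpose_mat E * ((1\<^sub>m ?l + N) * E)"
  proof -
    have "(1\<^sub>m ?l + N) * E = E + N * E"
      using E N by (simp add: add_mult_distrib_mat[of _ ?l ?l])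
    moreover have "transpose_mat E * (E + N * E) = transpose_mat E * E + transpose_mat E * (N * E)"
      using E N by (intro mult_add_distrib_mat) auto
    moreover have "transpose_mat (D * E) * (D * E) = transpose_mat E * (N * E)"
      unfolding N_eq transpose_mult[OF D E]
      using D E by (simp add: assoc_mult_mat[of _ "length cs" ?l _ "length gs" _ "length cs"]
          assoc_mult_mat[of _ ?l "length gs" _ ?l _ "length cs"])
    ultimately show ?thesis
      by simp
  qed
  \<comment> \<open>Moving \<open>E^T\<close> to the right end changes the size from the number of
    facets to that of the link, where \<open>N * L = 0\<close> can be used.\<close>
  finally have "nonzero_eigenvalues (col_gram (Pow V) cs)
      = nonzero_eigenvalues (((1\<^sub>m ?l + N) * E) * transpose_mat E)"
    using nonzero_eigenvalues_mult_commute[of "transpose_mat E" "length cs" ?l "(1\<^sub>m ?l + N) * E"]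
      E mult_carrier_mat[OF add_carrier_mat[OF N] E] by simp
  also have "((1\<^sub>m ?l + N) * E) * transpose_mat E = (1\<^sub>m ?l + N) * (E * transpose_mat E)"
    using E N by (intro assoc_mult_mat) auto
  \<comment> \<open>Facets through \<open>v\<close> yield the identity, since each determines one
    link face; the others yield \<open>L\<close>.\<close>
  also have "E * transpose_mat E = 1\<^sub>m ?l + L"
    unfolding E_def L_def row_gram_def indexed_mat_one[OF dist(2), symmetric] indexed_mat_add
      indexed_mat_transpose indexed_mat_mult[OF dist(1)]
  proof (rule indexed_mat_cong)
    fix H H' assume H: "H \<in> set ls" "H' \<in> set ls"
    let ?f = "\<lambda>F. incidence H F * incidence H' F"
    have H': "v \<notin> H" "v \<notin> H'" "insert v H \<in> set cs"
      using H ls by simp_all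
    have "(\<Sum>F\<in>set cs. ?f F) = (\<Sum>F\<in>set cs - set ds. ?f F) + (\<Sum>F\<in>set ds. ?f F)"
      using ds by (intro sum.subset_diff) auto
    also have "(\<Sum>F\<in>set cs - set ds. ?f F) = (\<Sum>F\<in>{insert v H}. ?f F)"
    proof (rule sum.mono_neutral_right)
      show "{insert v H} \<subseteq> set cs - set ds"
        using H' ds by simp
      show "\<forall>F\<in>set cs - set ds - {insert v H}. ?f F = 0"
      proof
        fix F assume F: "F \<in> set cs - set ds - {insert v H}"
        then have "F \<in> Pow V" "v \<in> F"
          using cs ds by blast+
        then show "?f F = 0"
          using F inc_v[of F H] H'(1) by simp
      qed
    qed simp
    also have "\<dots> = ?f (insert v H)"
      by simp
    also have "\<dots> = (if H = H' then 1 else 0)"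
    proof -
      have "insert v H = insert v H' \<longleftrightarrow> H = H'"
        using H' by (simp add: insert_ident)
      moreover have "insert v H \<in> Pow V"
        using H' cs by blast
      ultimately show ?thesis
        using H' inc_v[of "insert v H" H] inc_v[of "insert v H" H']
        by (simp add: position_sign_square)
    qed
    finally show "(\<Sum>F\<in>set cs. ?f F) = (if H = H' then 1 else 0) + (\<Sum>F\<in>set ds. ?f F)" .
  qed
  also note prod
  finally have spec: "nonzero_eigenvalues (col_gram (Pow V) cs)
      = nonzero_eigenvalues (1\<^sub>m ?l + (N + L))" .
  have NL': "N + L \<in> carrier_mat ?l ?l"
    using N L by auto
  \<comment> \<open>The degree bounds the number of roots, \<open>N * L = 0\<close> splits the
    nonzero ones, and adding the identity shifts each by 1.\<close>
  let ?A = "proots (char_poly (N + L))"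
  show ?thesis
  proof (intro exI[of _ ?A] conjI)
    show "size ?A \<le> ?l"
      using size_proots_le[of "char_poly (N + L)"] degree_monic_char_poly[OF NL'] by simp
    have "nonzero_eigenvalues L = nonzero_eigenvalues (col_gram (Pow ?W) ds)"
      unfolding L_def using dist near dsW V by (intro nonzero_eigenvalues_row_gram) auto
    then show "filter_mset (\<lambda>x. x \<noteq> 0) ?A = nonzero_eigenvalues (col_gram (Pow ?W) ds)
        + nonzero_eigenvalues (col_gram (Pow ?W) ls)"
      using nonzero_eigenvalues_add_orthogonal[OF N L NL]
      by (simp add: N_def nonzero_eigenvalues_def add.commute)
    show "nonzero_eigenvalues (col_gram (Pow V) cs)
        = filter_mset (\<lambda>x. x \<noteq> 0) (image_mset (\<lambda>x. x + 1) ?A)"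
      unfolding spec
      unfolding nonzero_eigenvalues_def char_poly_one_add[OF NL']
      by (simp add: proots_pcompose_linear[OF char_poly_nonzero[OF NL']])
  qed
qed

text \<open>The only row met is the empty face, and the 1 by 1 Laplacian has the number of points as
  its entry. Inclusion instead of equality allows for an empty list, where the root is 0.\<close>

lemma points_spectrum:
  assumes "finite V" "distinct ls" and ls: "\<And>H. H \<in> set ls \<Longrightarrow> H \<subseteq> V \<and> card H = 1"
  shows "nonzero_eigenvalues (col_gram (Pow V) ls) \<subseteq># {#real (length ls)#}"
proof -
  have remove: "H - {v} = {}" if "H \<in> set ls" "v \<in> H" for H v
    using that ls[of H] by (auto simp: card_1_singleton_iff)
  have "incidence {} H * incidence {} H = 1" if H: "H \<in> set ls" for H
  proof -
    obtain v where "H = {v}"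
      using ls[OF H] by (auto simp: card_1_singleton_iff)
    then show ?thesis
      using incidence_remove[of H v] by (simp add: position_sign_square)
  qed
  then have "(\<Sum>H\<in>set ls. incidence {} H * incidence {} H) = real (length ls)"
    using assms(2) by (simp add: distinct_card)
  then have "diag_mat (row_gram [{}] (set ls)) = [real (length ls)]"
    by (simp add: row_gram_def indexed_mat_def diag_mat_def)
  then have "char_poly (row_gram [{}] (set ls)) = [:- real (length ls), 1:]"
    using char_poly_upper_triangular[of "row_gram [{}] (set ls)" 1] row_gram_carrier[of "[{}]"]
    by (simp add: upper_triangular_def)
  then have "nonzero_eigenvalues (row_gram [{}] (set ls)) \<subseteq># {#real (length ls)#}"
    unfolding nonzero_eigenvalues_def by simp
  also have "nonzero_eigenvalues (row_gram [{}] (set ls)) = nonzero_eigenvalues (col_gram (Pow V) ls)"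
    using assms remove by (intro nonzero_eigenvalues_row_gram) auto
  finally show ?thesis .
qed

section \<open>Induction on the number of vertices\<close>

lemma size_nonzero_eigenvalues_le:
  assumes "A \<in> carrier_mat n n"
  shows "size (nonzero_eigenvalues A) \<le> n"
  using size_filter_mset_lesseq[of "\<lambda>x. x \<noteq> 0" "proots (char_poly A)"]
    size_proots_le[of "char_poly A"] degree_monic_char_poly[OF assms]
  unfolding nonzero_eigenvalues_def by linarith

lemma sum_mset_filter_nonzero:
  fixes M :: "'a :: comm_monoid_add multiset"
  shows "sum_mset (filter_mset (\<lambda>x. x \<noteq> 0) M) = sum_mset M"
  by (induction M) auto

text \<open>For \<open>a > 0\<close> both upper arguments are at most \<open>a + b + k - 1\<close>,
  and Pascal's rule adds the enlarged terms. For \<open>a = 0\<close> the first term vanishes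
  because \<open>k \<ge> 1\<close>.\<close>

lemma choose_split_le:
  fixes a b k :: nat
  assumes "k \<ge> 1"
  shows "((a + k - 1) choose k) + ((b + k) choose Suc k) \<le> (a + b + k) choose Suc k"
proof (cases a)
  case 0
  then show ?thesis
    using assms by (simp add: binomial_eq_0)
next
  case (Suc a')
  have "((a + k - 1) choose k) + ((b + k) choose Suc k)
      \<le> ((a' + b + k) choose k) + ((a' + b + k) choose Suc k)"
    using Suc by (intro add_mono binomial_right_mono) auto
  then show ?thesis
    using Suc by simp
qed

text \<open>Generalised for induction: any finite vertex set, an injective labelling, possibly no
  facets. \<open>B\<close> is arbitrary because its parts falling to link and deletion need not be
  the largest eigenvalues there.\<close>

lemma shifted_spectrum_bound:
  fixes \<pi> :: "nat \<Rightarrow> nat"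
  assumes "finite V" "inj_on \<pi> V" "k \<ge> 2" "distinct cs"
    and "\<And>F. F \<in> set cs \<Longrightarrow> F \<subseteq> V \<and> card F = k"
    and "\<And>F x u. F \<in> set cs \<Longrightarrow> x \<in> F \<Longrightarrow> u \<in> V \<Longrightarrow> u \<notin> F \<Longrightarrow> \<pi> u < \<pi> x
      \<Longrightarrow> insert u (F - {x}) \<in> set cs"
    and "B \<subseteq># nonzero_eigenvalues (col_gram (Pow V) cs)"
  shows "sum_mset B \<le> real (k - 1) * real (length cs) + real ((size B + k - 1) choose k)"
  using assms
proof (induction "card V" arbitrary: V k cs B rule: less_induct)
  case less
  note fin = less.prems(1) and inj = less.prems(2) and k = less.prems(3) and dist = less.prems(4)
    and cs = less.prems(5) and exch = less.prems(6) and B = less.prems(7)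
  show ?case
  proof (cases "V = {}")
    case True
    have "cs = []"
      using cs[of "hd cs"] True k by (cases cs) auto
    then have "B = {#}"
      using B size_nonzero_eigenvalues_le[OF col_gram_carrier, of "Pow V" cs] by simp
    then show ?thesis
      by simp
  next
    case False
    \<comment> \<open>The apex is the vertex of least label, so any vertex of a facet avoiding it
      may be exchanged for it.\<close>
    define v where "v = inv_into V \<pi> (Min (\<pi> ` V))"
    have Min: "Min (\<pi> ` V) \<in> \<pi> ` V"
      using fin False by simp
    have v: "v \<in> V"
      unfolding v_def by (rule inv_into_into[OF Min])
    have "\<pi> v = Min (\<pi> ` V)"
      unfolding v_def by (rule f_inv_into_f[OF Min])
    then have least: "\<pi> v < \<pi> u" if "u \<in> V" "u \<noteq> v" for u
      using that v fin inj Min_le[of "\<pi> ` V" "\<pi> u"] by (auto simp: inj_on_def order_le_less)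
    let ?W = "V - {v}"
    have W: "card ?W < card V" "finite ?W" "inj_on \<pi> ?W"
      using card_Diff1_less[OF fin v] fin inj by (auto intro: inj_on_subset)
    have csV: "set cs \<subseteq> Pow V"
      using cs by auto
    have bij: "bij_betw (insert v) {H. v \<notin> H \<and> insert v H \<in> set cs} {F \<in> set cs. v \<in> F}"
      by (rule bij_betw_byWitness[of _ "\<lambda>F. F - {v}"]) (auto simp: insert_absorb)
    obtain ls where ls: "set ls = {H. v \<notin> H \<and> insert v H \<in> set cs}" "distinct ls"
      using finite_distinct_list[of "{H. v \<notin> H \<and> insert v H \<in> set cs}"] bij_betw_finite[OF bij]
      by auto
    obtain ds where ds: "set ds = {F \<in> set cs. v \<notin> F}" "distinct ds"
      using finite_distinct_list[of "{F \<in> set cs. v \<notin> F}"] by auto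
    have len: "length cs = length ls + length ds"
    proof -
      have "{F \<in> set cs. v \<in> F} \<union> {F \<in> set cs. v \<notin> F} = set cs"
        by auto
      then have "length cs = card ({F \<in> set cs. v \<in> F} \<union> {F \<in> set cs. v \<notin> F})"
        using dist by (simp add: distinct_card)
      also have "\<dots> = card {F \<in> set cs. v \<in> F} + card {F \<in> set cs. v \<notin> F}"
        by (rule card_Un_disjoint) auto
      also have "\<dots> = length ls + length ds"
        using bij_betw_same_card[OF bij] ls ds by (metis distinct_card)
      finally show ?thesis .
    qed
    have near: "F - {w} \<in> set ls" if "F \<in> set ds" "w \<in> F" for F w
    proof -
      have F: "F \<in> set cs" "v \<notin> F"
        using that ds by auto
      then have "insert v (F - {w}) \<in> set cs"
        using cs[OF F(1)] that v by (intro exch least) auto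
      then show ?thesis
        using F ls by simp
    qed
    have dsB: "sum_mset M \<le> real (k - 1) * real (length ds) + real ((size M + k - 1) choose k)"
      if "M \<subseteq># nonzero_eigenvalues (col_gram (Pow ?W) ds)" for M
    proof (rule less.hyps[OF W k ds(2)])
      show "F \<subseteq> ?W \<and> card F = k" if "F \<in> set ds" for F
        using that ds cs[of F] by auto
      show "insert u (F - {x}) \<in> set ds"
        if "F \<in> set ds" "x \<in> F" "u \<in> ?W" "u \<notin> F" "\<pi> u < \<pi> x" for F x u
        using that ds exch[of F x u] by auto
    qed (rule that)
    have lsV: "H \<subseteq> ?W \<and> card H = k - 1" if "H \<in> set ls" for H
    proof -
      have H: "v \<notin> H" "insert v H \<in> set cs"
        using that ls by auto
      then have "finite H"
        using cs[OF H(2)] fin finite_subset by auto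
      then show ?thesis
        using cs[OF H(2)] H by auto
    qed
    \<comment> \<open>The link has parameter \<open>k - 1\<close>, and the induction hypothesis
      requires this to be at least 2.\<close>
    have lsB: "sum_mset M \<le> real (k - 1 - 1) * real (length ls)
        + real ((size M + (k - 1) - 1) choose (k - 1))"
      if "k \<ge> 3" "M \<subseteq># nonzero_eigenvalues (col_gram (Pow ?W) ls)" for M
    proof (rule less.hyps[OF W _ ls(2) lsV])
      show "insert u (H - {x}) \<in> set ls"
        if "H \<in> set ls" "x \<in> H" "u \<in> ?W" "u \<notin> H" "\<pi> u < \<pi> x" for H x u
      proof -
        have H: "v \<notin> H" "insert v H \<in> set cs" "x \<noteq> v" "u \<noteq> v"
          using that ls by auto
        then have "insert u (insert v H - {x}) \<in> set cs"
          using that by (intro exch) auto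
        also have "insert u (insert v H - {x}) = insert v (insert u (H - {x}))"
          using H by auto
        finally show ?thesis
          using H ls by simp
      qed
    qed (use that in auto)
    obtain A where A: "size A \<le> length ls"
      "filter_mset (\<lambda>x. x \<noteq> 0) A = nonzero_eigenvalues (col_gram (Pow ?W) ds)
        + nonzero_eigenvalues (col_gram (Pow ?W) ls)"
      "nonzero_eigenvalues (col_gram (Pow V) cs)
        = filter_mset (\<lambda>x. x \<noteq> 0) (image_mset (\<lambda>x. x + 1) A)"
      using near_cone_spectrum[OF fin v dist ls(2) ds(2) csV ls(1) ds(1) near] by blast
    \<comment> \<open>Undoes the shift by 1, so that \<open>C\<close> lies inside
      \<open>A\<close>.\<close>
    define C where "C = image_mset (\<lambda>x. x - 1) B"
    have BC: "B = image_mset (\<lambda>x. x + 1) C"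
      by (simp add: C_def image_mset.compositionality comp_def)
    have "B \<subseteq># image_mset (\<lambda>x. x + 1) A"
      using B unfolding A(3) by (rule subset_mset.order_trans) simp
    then have "C \<subseteq># image_mset (\<lambda>x. x - 1) (image_mset (\<lambda>x. x + 1) A)"
      unfolding C_def by (rule image_mset_subseteq_mono)
    then have CA: "C \<subseteq># A"
      by (simp add: image_mset.compositionality comp_def)
    have sumB: "sum_mset B = sum_mset C + real (size B)" and "size B = size C"
      unfolding BC by (simp_all add: sum_mset.distrib)
    \<comment> \<open>The ones add up to \<open>size B\<close>, at most one per link face; this
      raises the factor \<open>k - 2\<close> of the link to \<open>k - 1\<close>.\<close>
    then have sizeB: "size B \<le> length ls"
      using size_mset_mono[OF CA] A(1) by simp
    define C' where "C' = filter_mset (\<lambda>x. x \<noteq> 0) C"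
    have sumC: "sum_mset C = sum_mset C'"
      by (simp add: C'_def sum_mset_filter_nonzero)
    have sizeC: "size C' \<le> size B"
      unfolding C'_def \<open>size B = size C\<close> by (rule size_filter_mset_lesseq)
    have C': "C' \<subseteq># nonzero_eigenvalues (col_gram (Pow ?W) ds)
        + nonzero_eigenvalues (col_gram (Pow ?W) ls)"
      unfolding C'_def A(2)[symmetric] using CA by (rule multiset_filter_mono)
    \<comment> \<open>As much of \<open>C'\<close> as possible is assigned to the link; multiset
      subtraction leaves the rest inside the spectrum of the deletion.\<close>
    define C1 where "C1 = C' \<inter># nonzero_eigenvalues (col_gram (Pow ?W) ls)"
    define C2 where "C2 = C' - nonzero_eigenvalues (col_gram (Pow ?W) ls)"
    have split: "C' = C1 + C2"
      unfolding C1_def C2_def by (rule multiset_eqI) simp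
    have C1: "C1 \<subseteq># nonzero_eigenvalues (col_gram (Pow ?W) ls)"
      by (simp add: C1_def)
    have C2: "C2 \<subseteq># nonzero_eigenvalues (col_gram (Pow ?W) ds)"
      using C' by (simp add: C2_def subset_eq_diff_conv)
    have sum: "sum_mset B = sum_mset C1 + sum_mset C2 + real (size B)"
      and size: "size C1 + size C2 \<le> size B"
      using sumB sumC sizeC by (simp_all add: split)
    show ?thesis
    proof (cases "k = 2")
      case False
      then have "k \<ge> 3"
        using k by simp
      then obtain j where j: "k = Suc j" "j \<ge> 2"
        by (cases k) auto
      have "sum_mset B \<le> real (j - 1) * real (length ls) + real ((size C1 + j - 1) choose j)
          + (real j * real (length ds) + real ((size C2 + j) choose Suc j)) + real (length ls)"
        using lsB[OF \<open>k \<ge> 3\<close> C1] dsB[OF C2] sum sizeB by (simp add: j)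
      also have "\<dots> = real j * real (length cs)
          + real (((size C1 + j - 1) choose j) + ((size C2 + j) choose Suc j))"
        using j by (simp add: len algebra_simps of_nat_diff)
      also have "\<dots> \<le> real j * real (length cs) + real ((size C1 + size C2 + j) choose Suc j)"
        using choose_split_le[of j "size C1" "size C2"] j by simp
      also have "\<dots> \<le> real j * real (length cs) + real ((size B + j) choose Suc j)"
        using size by (simp add: binomial_right_mono)
      finally show ?thesis
        by (simp add: j)
    next
      case True
      have "C1 \<subseteq># {#real (length ls)#}"
        using W ls lsV True by (intro subset_mset.order_trans[OF C1 points_spectrum]) auto
      then consider "C1 = {#}" | "C1 = {#real (length ls)#}"
        by (auto simp: subset_mset.le_iff_add single_is_union)
      then show ?thesis
      proof cases
        case 1
        have "(size C2 + 1) choose 2 \<le> (size B + 1) choose 2"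
          using size by (intro binomial_right_mono) simp
        then show ?thesis
          using sum dsB[OF C2] sizeB 1 True len by simp
      next
        case 2
        then obtain s where s: "size B = Suc s" "size C2 \<le> s"
          using size by (cases "size B") auto
        have "(size C2 + 1) choose 2 \<le> (s + 1) choose 2"
          using s by (intro binomial_right_mono) simp
        \<comment> \<open>The link eigenvalue already uses up \<open>length ls\<close>, so the ones
          are paid for by the binomial, whose increment is exactly \<open>size B\<close>.\<close>
        moreover have "(size B + 1) choose 2 = size B + ((s + 1) choose 2)"
          by (simp add: s numeral_2_eq_2)
        ultimately show ?thesis
          using sum dsB[OF C2] 2 True len by simp
      qed
    qed
  qed
qed

section \<open>The Laplacian spectrum\<close>

text \<open>The index of a vertex in the sorted list counts the smaller vertices, and distinctness
  makes it unique, so the definite description yields the exponent in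
  \<open>position_sign\<close>.\<close>

lemma boundary_entry_eq_incidence:
  assumes "finite F"
  shows "boundary_entry G F = incidence G F"
proof -
  let ?xs = "sorted_list_of_set F"
  have xs: "set ?xs = F" "distinct ?xs" "length ?xs = card F" "sorted_wrt (<) ?xs"
    using assms by auto
  show ?thesis
  proof (cases "\<exists>j < card F. G = F - {?xs ! j}")
    case True
    then obtain j where j: "j < card F" "G = F - {?xs ! j}"
      by blast
    have mem: "?xs ! i \<in> F" if "i < card F" for i
      using that xs nth_mem by metis
    have "i = j" if "i < card F" "G = F - {?xs ! i}" for i
    proof -
      have "?xs ! i = ?xs ! j"
        using that j mem[of i] mem[of j] by blast
      then show ?thesis
        using that j xs by (simp add: nth_eq_iff_index_eq)
    qed
    then have "(THE j. j < card F \<and> G = F - {?xs ! j}) = j"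
      using j by (intro the_equality) auto
    moreover have "{u \<in> F. u < ?xs ! j} = (!) ?xs ` {..<j}"
    proof (intro subset_antisym subsetI)
      fix u assume u: "u \<in> {u \<in> F. u < ?xs ! j}"
      then obtain i where i: "i < card F" "u = ?xs ! i"
        using xs by (metis (no_types, lifting) in_set_conv_nth mem_Collect_eq)
      moreover have "\<not> j \<le> i"
        using u i xs j sorted_wrt_nth_less[OF xs(4), of j i] by (auto simp: order_le_less)
      ultimately show "u \<in> (!) ?xs ` {..<j}"
        by simp
    next
      fix u assume "u \<in> (!) ?xs ` {..<j}"
      then show "u \<in> {u \<in> F. u < ?xs ! j}"
        using j mem xs sorted_wrt_nth_less[OF xs(4), of _ j] by auto
    qed
    moreover have "inj_on ((!) ?xs) {..<j}"
      using j xs by (intro inj_on_nth) auto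
    ultimately show ?thesis
      using j assms mem True incidence_remove[of F "?xs ! j"]
      by (simp add: boundary_entry_def position_sign_def card_image)
  next
    case False
    then have "incidence G F = 0"
      using xs by (intro incidence_eq_0) (metis in_set_conv_nth)
    then show ?thesis
      using False by (simp add: boundary_entry_def)
  qed
qed

lemma subsets_of_card_props:
  "distinct (subsets_of_card n m)" "set (subsets_of_card n m) = {G. G \<subseteq> {1..n} \<and> card G = m}"
proof -
  show "distinct (subsets_of_card n m)"
    unfolding subsets_of_card_def by (intro distinct_filter distinct_set_subseqs) simp
  have "set (map set (subseqs [1..<Suc n])) = Pow {1..n}"
    unfolding set_map subseqs_powset set_upt atLeastLessThanSuc_atLeastAtMost ..
  then show "set (subsets_of_card n m) = {G. G \<subseteq> {1..n} \<and> card G = m}"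
    unfolding subsets_of_card_def by auto
qed

lemma laplacian_eq_row_gram:
  "laplacian n k S = row_gram (subsets_of_card n (k - 1)) (set (facet_list n k S))"
proof -
  have "distinct (facet_list n k S)"
    by (simp add: facet_list_def subsets_of_card_props)
  moreover have "boundary_mat n k S
      = indexed_mat (subsets_of_card n (k - 1)) (facet_list n k S) incidence"
    unfolding boundary_mat_def Let_def indexed_mat_def[symmetric]
    by (intro indexed_mat_cong boundary_entry_eq_incidence)
      (auto simp: facet_list_def subsets_of_card_props intro: finite_subset)
  ultimately show ?thesis
    unfolding laplacian_def by (simp add: row_gram_eq)
qed

lemma sum_laplacian_eigenvalues:
  "(\<Sum>i = 1..t. laplacian_eigenvalue n k S i) = sum_list (take t (laplacian_spectrum n k S))"
proof -
  let ?sp = "laplacian_spectrum n k S"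
  have "(\<Sum>i = 1..t. laplacian_eigenvalue n k S i) = (\<Sum>i<t. laplacian_eigenvalue n k S (Suc i))"
    using sum.atLeast1_atMost_eq[of "laplacian_eigenvalue n k S" t] by simp
  \<comment> \<open>Past the end of the spectrum the default 0 applies, so the sum may be cut at the
    length.\<close>
  also have "\<dots> = (\<Sum>i\<in>{0..<min (length ?sp) t}. laplacian_eigenvalue n k S (Suc i))"
    by (rule sum.mono_neutral_right) (auto simp: laplacian_eigenvalue_def)
  also have "\<dots> = sum_list (take t ?sp)"
    unfolding sum_list_sum_nth by (intro sum.cong) (auto simp: laplacian_eigenvalue_def)
  finally show ?thesis .
qed

theorem theorem23:
  fixes n k t :: nat and S :: "nat set set"
  assumes "k \<ge> 2"
    and "k_family n k S"
    and "shifted n S"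
    and "t \<ge> 1"
  shows "(\<Sum>i = 1..t. laplacian_eigenvalue n k S i)
           \<le> real (k - 1) * real (card S) + real ((t + k - 1) choose k)"
proof -
  let ?cs = "facet_list n k S" and ?sp = "laplacian_spectrum n k S" and ?V = "{1..n}"
  have S: "F \<subseteq> ?V \<and> card F = k" if "F \<in> S" for F
    using that assms(2) by (simp add: k_family_def)
  have cs: "set ?cs = S" "distinct ?cs"
    using S by (auto simp: facet_list_def subsets_of_card_props)
  obtain \<pi> where \<pi>: "bij_betw \<pi> ?V ?V" "exchange_closed n ((`) \<pi> ` S)"
    using assms(3) by (auto simp: shifted_def)
  have inj: "inj_on \<pi> ?V"
    using \<pi>(1) by (rule bij_betw_imp_inj_on)
  \<comment> \<open>Exchange is pulled back along \<open>\<pi>\<close>: facets and signs keep the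
    original order, and only the comparison of vertices uses labels.\<close>
  have exch: "insert u (F - {x}) \<in> S"
    if "F \<in> S" "x \<in> F" "u \<in> ?V" "u \<notin> F" "\<pi> u < \<pi> x" for F x u
  proof -
    have F: "F \<subseteq> ?V"
      using S that by blast
    have "\<pi> u \<in> ?V"
      using that(3) \<pi>(1) by (rule bij_betwE[THEN bspec, rotated])
    moreover have "\<pi> u \<notin> \<pi> ` F"
      using that(4) inj_on_image_mem_iff[OF inj that(3) F] by simp
    ultimately have "insert (\<pi> u) (\<pi> ` F - {\<pi> x}) \<in> (`) \<pi> ` S"
      using \<pi>(2) that unfolding exchange_closed_def by blast
    moreover have "\<pi> ` F - {\<pi> x} = \<pi> ` (F - {x})"
      using inj_on_image_set_diff[OF inj, of F "{x}"] F that(2) by (simp add: subset_iff)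
    ultimately obtain F' where F': "F' \<in> S" "\<pi> ` insert u (F - {x}) = \<pi> ` F'"
      by auto
    then have "insert u (F - {x}) = F'"
      using inj_on_image_eq_iff[OF inj, of "insert u (F - {x})" F'] F that S[of F'] by auto
    then show ?thesis
      using F' by simp
  qed
  have "nonzero_eigenvalues (laplacian n k S) = nonzero_eigenvalues (col_gram (Pow ?V) ?cs)"
    unfolding laplacian_eq_row_gram
  proof (rule nonzero_eigenvalues_row_gram)
    fix F v assume "F \<in> set ?cs" "v \<in> F"
    then show "F - {v} \<in> set (subsets_of_card n (k - 1)) \<inter> Pow ?V"
      using S[of F] cs by (auto simp: subsets_of_card_props card_Diff_singleton)
  qed (auto simp: subsets_of_card_props cs)
  \<comment> \<open>Dropping zeros keeps the sum and places the first \<open>t\<close> eigenvalues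
    inside the nonzero spectrum. Fewer than \<open>t\<close> may remain, which monotonicity of the
    binomial absorbs.\<close>
  moreover define B where "B = filter_mset (\<lambda>x. x \<noteq> 0) (mset (take t ?sp))"
  moreover have "mset (take t ?sp) \<subseteq># proots (char_poly (laplacian n k S))"
  proof -
    have "mset (take t ?sp) \<subseteq># mset (take t ?sp) + mset (drop t ?sp)"
      by simp
    also have "\<dots> = mset ?sp"
      by (metis append_take_drop_id mset_append)
    finally show ?thesis
      by (simp add: laplacian_spectrum_def)
  qed
  ultimately have B: "B \<subseteq># nonzero_eigenvalues (col_gram (Pow ?V) ?cs)"
    by (metis multiset_filter_mono nonzero_eigenvalues_def)
  have sizeB: "size B \<le> t"
    using size_filter_mset_lesseq[of "\<lambda>x. x \<noteq> 0" "mset (take t ?sp)"]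
    unfolding B_def by (rule order_trans) simp
  have "(\<Sum>i = 1..t. laplacian_eigenvalue n k S i) = sum_mset B"
    unfolding sum_laplacian_eigenvalues B_def sum_mset_filter_nonzero by (simp add: sum_mset_sum_list)
  also have "\<dots> \<le> real (k - 1) * real (length ?cs) + real ((size B + k - 1) choose k)"
    using inj assms(1) cs S exch B by (intro shifted_spectrum_bound[where V = ?V and \<pi> = \<pi>]) auto
  also have "\<dots> \<le> real (k - 1) * real (card S) + real ((t + k - 1) choose k)"
  proof -
    have "(size B + k - 1) choose k \<le> (t + k - 1) choose k"
      using sizeB by (intro binomial_right_mono) simp
    then show ?thesis
      using cs distinct_card[of ?cs] by simp
  qed
  finally show ?thesis .
qed

end
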